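(* Fix a time $t\in[0,1)$. Assume that $P_{1\mid t}(\mathbf{x}_1\mid\mathbf{x}_t)$ and $q_t(\mathbf{x}_t\mid\mathbf{x}_1)$ have full support on $[K]$ and $\mathbb{S}_K$, respectively. Further assume that the conditional independence $q_t(\mathbf{x}_t'\mid\mathbf{x}_t,\mathbf{x}_1)=q_t(\mathbf{x}_t'\mid\mathbf{x}_1)$ holds. Then the Markov kernel $$p_{t'\mid t}(\mathbf{x}_t'\mid\mathbf{x}_t)=\sum_{\mathbf{x}_1}P_{1\mid t}(\mathbf{x}_1\mid\mathbf{x}_t)\,q_t(\mathbf{x}_t'\mid\mathbf{x}_1)$$ converges to the stationary distribution $$\pi_t(\mathbf{x}_t)=\sum_{\mathbf{x}_1}p(\mathbf{x}_1)\,q_t(\mathbf{x}_t\mid\mathbf{x}_1),$$ where both sums run over the $K$ possible values $\mathbf{x}_1\in\{\mathbf{e}_1,\dots,\mathbf{e}_K\}$ of the clean variable.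
   Context: This is the univariate case: a single categorical variable with $K$ categories. $\mathbb{S}_K=\{\mathbf{x}\in\mathbb{R}^K : \sum_j x_j=1,\ x_j>0\ \forall j\}$ is the probability simplex, and the category $k\in[K]=\{1,\dots,K\}$ is represented by the standard basis vector $\mathbf{e}_k$ of $\mathbb{R}^K$ (a vertex of the simplex). The clean variable $\mathbf{x}_1$ takes values in $\{\mathbf{e}_1,\dots,\mathbf{e}_K\}$ (identified with $[K]$) and has distribution $p$ (the data distribution). For each $\mathbf{x}_1$, $q_t(\cdot\mid\mathbf{x}_1)$ is the noising distribution at time $t$, a probability density on $\mathbb{S}_K$, from which the noisy state $\mathbf{x}_t$ is drawn. $P_{1\mid t}(\mathbf{x}_1\mid\mathbf{x}_t)\propto p(\mathbf{x}_1)\,q_t(\mathbf{x}_t\mid\mathbf{x}_1)$ is the (true) posterior distribution of the clean variable given the noisy state. $\mathbf{x}_t'$ denotes a new noisy state at the same time $t$: a step of the kernel from $\mathbf{x}_t$ draws $\mathbf{x}_1\sim P_{1\mid t}(\cdot\mid\mathbf{x}_t)$ and then $\mathbf{x}_t'\sim q_t(\cdot\mid\mathbf{x}_1)$, with the time index kept fixed. *)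

theory Defs
  imports "HOL-Probability.Probability"
begin

text \<open>
  The number of categories is \<open>K = CARD('k)\<close>. A category is represented by the corresponding
  standard basis vector. The order of arguments follows the conditional-density notation:
  the conditioned variable comes first, the conditioning variables after it.
\<close>

definition categories :: "(real ^ 'k) set" where
  "categories = range (\<lambda>k. axis k 1)"

definition prob_simplex :: "(real ^ 'k) set" where
  "prob_simplex = {x. (\<Sum>j\<in>UNIV. x $ j) = 1 \<and> (\<forall>j. 0 < x $ j)}"

text \<open>
  Densities on the simplex are taken with respect to \<open>(K - 1)\<close>-dimensional Lebesgue measure, i.e.
  Lebesgue measure in all coordinates but one, the remaining coordinate being determined by the
  constraint that the coordinates sum to 1. The measure does not depend on the coordinate \<open>i\<close>
  that is left out, since the change of coordinates is a shear composed with a permutation and a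
  reflection; it equals surface measure up to the constant factor \<open>sqrt K\<close>. For \<open>K = 1\<close> it is
  the unit point mass on the one-point simplex. The underlying measurable space is the simplex
  with its Borel sets.
\<close>

definition simplex_chart :: "'k \<Rightarrow> ('k \<Rightarrow> real) \<Rightarrow> real ^ 'k" where
  "simplex_chart i y = (\<chi> j. if j = i then 1 - (\<Sum>l\<in>UNIV - {i}. y l) else y j)"

definition simplex_measure :: "(real ^ 'k) measure" where
  "simplex_measure =
     (let i = (SOME i. True) in
      restrict_space (distr (\<Pi>\<^sub>M j\<in>UNIV - {i}. lborel) borel (simplex_chart i)) prob_simplex)"

definition simplex_density :: "(real ^ 'k \<Rightarrow> real) \<Rightarrow> bool" where
  "simplex_density f \<longleftrightarrow>
     f \<in> borel_measurable simplex_measure \<and> (\<forall>x\<in>prob_simplex. 0 \<le> f x) \<and>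
     (\<integral>\<^sup>+x. ennreal (f x) \<partial>simplex_measure) = 1"

definition posterior ::
  "(real ^ 'k) pmf \<Rightarrow> (real ^ 'k \<Rightarrow> real ^ 'k \<Rightarrow> real) \<Rightarrow> real ^ 'k \<Rightarrow> real ^ 'k \<Rightarrow> real" where
  "posterior p q x1 x = pmf p x1 * q x x1 / (\<Sum>y\<in>categories. pmf p y * q x y)"

text \<open>
  Density at \<open>x'\<close> of the new state after one step from \<open>x\<close>: draw \<open>x1\<close> from the posterior given
  \<open>x\<close>, then draw \<open>x'\<close> from the conditional density \<open>r x' x x1\<close> given both \<open>x\<close> and \<open>x1\<close>.
  That \<open>r\<close> does not depend on \<open>x\<close> is the conditional independence assumption; it is not built in.
\<close>

definition transition_density ::
  "(real ^ 'k) pmf \<Rightarrow> (real ^ 'k \<Rightarrow> real ^ 'k \<Rightarrow> real) \<Rightarrow>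
   (real ^ 'k \<Rightarrow> real ^ 'k \<Rightarrow> real ^ 'k \<Rightarrow> real) \<Rightarrow> real ^ 'k \<Rightarrow> real ^ 'k \<Rightarrow> real" where
  "transition_density p q r x' x = (\<Sum>x1\<in>categories. posterior p q x1 x * r x' x x1)"

definition transition_kernel ::
  "(real ^ 'k) pmf \<Rightarrow> (real ^ 'k \<Rightarrow> real ^ 'k \<Rightarrow> real) \<Rightarrow>
   (real ^ 'k \<Rightarrow> real ^ 'k \<Rightarrow> real ^ 'k \<Rightarrow> real) \<Rightarrow> real ^ 'k \<Rightarrow> (real ^ 'k) measure" where
  "transition_kernel p q r x =
     density simplex_measure (\<lambda>x'. ennreal (transition_density p q r x' x))"

definition noisy_marginal ::
  "(real ^ 'k) pmf \<Rightarrow> (real ^ 'k \<Rightarrow> real ^ 'k \<Rightarrow> real) \<Rightarrow> (real ^ 'k) measure" where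
  "noisy_marginal p q =
     density simplex_measure (\<lambda>x. ennreal (\<Sum>x1\<in>categories. pmf p x1 * q x x1))"

text \<open>The law after \<open>n\<close> steps of the kernel \<open>\<kappa>\<close> with initial law \<open>\<nu>\<close>.\<close>

definition chain_law :: "('a \<Rightarrow> 'a measure) \<Rightarrow> 'a measure \<Rightarrow> nat \<Rightarrow> 'a measure" where
  "chain_law \<kappa> \<nu> n = ((\<lambda>M. M \<bind> \<kappa>) ^^ n) \<nu>"

text \<open>Meaningful for probability measures with the same measurable sets.\<close>

definition tv_dist :: "'a measure \<Rightarrow> 'a measure \<Rightarrow> real" where
  "tv_dist M N = (SUP A\<in>sets M. \<bar>measure M A - measure N A\<bar>)"

end

theory Submission
  imports Defs
begin

text \<open>
  Let \<open>w\<^sub>i\<close> be the prior weight, \<open>Q\<^sub>i\<close> the noising law and \<open>P\<^sub>i\<close> the posterior weight of category \<open>i\<close>.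
  One step of the kernel replaces the current law \<open>\<nu>\<close> by the mixture of the \<open>Q\<^sub>i\<close> with weights
  \<open>\<integral> P\<^sub>i d\<nu>\<close>. From then on the weights evolve as a Markov chain on the finite set of categories
  with transition probabilities \<open>T\<^sub>j\<^sub>i = \<integral> P\<^sub>i dQ\<^sub>j\<close>, and by Bayes' rule \<open>w\<close> is stationary. All \<open>T\<^sub>j\<^sub>i\<close>
  are positive, so a Doeblin minorization \<open>T\<^sub>j\<^sub>i \<ge> \<epsilon> w\<^sub>i\<close> holds and the \<open>l\<^sub>1\<close> distance of the weights to \<open>w\<close>
  contracts by \<open>1 - \<epsilon>\<close> in each step; that distance bounds the total variation distance of the mixtures.
\<close>

section \<open>Contraction of signed weights of total mass zero\<close>

text \<open>Since \<open>a\<close> has total mass zero, subtracting \<open>\<epsilon> * w i\<close>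
  from every entry of column \<open>i\<close> leaves the sums unchanged. The reduced matrix is
  nonnegative and has row sums \<open>1 - \<epsilon>\<close>, so the triangle inequality yields the
  factor.\<close>

lemma doeblin_contraction:
  fixes T :: "'i \<Rightarrow> 'i \<Rightarrow> real"
  assumes rows: "\<And>j. j \<in> I \<Longrightarrow> (\<Sum>i\<in>I. T j i) = 1"
    and w: "(\<Sum>i\<in>I. w i) = 1"
    and minor: "\<And>i j. i \<in> I \<Longrightarrow> j \<in> I \<Longrightarrow> \<epsilon> * w i \<le> T j i"
    and a: "(\<Sum>j\<in>I. a j) = 0"
  shows "(\<Sum>i\<in>I. \<bar>\<Sum>j\<in>I. a j * T j i\<bar>) \<le> (1 - \<epsilon>) * (\<Sum>j\<in>I. \<bar>a j\<bar>)"
proof -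
  have "(\<Sum>j\<in>I. a j * T j i) = (\<Sum>j\<in>I. a j * (T j i - \<epsilon> * w i))" for i
  proof -
    have "(\<Sum>j\<in>I. a j * (\<epsilon> * w i)) = 0"
      using a by (simp flip: sum_distrib_right)
    then show ?thesis
      by (simp add: right_diff_distrib sum_subtractf)
  qed
  then have "(\<Sum>i\<in>I. \<bar>\<Sum>j\<in>I. a j * T j i\<bar>) \<le> (\<Sum>i\<in>I. \<Sum>j\<in>I. \<bar>a j\<bar> * (T j i - \<epsilon> * w i))"
    using minor by (auto intro!: sum_mono order.trans[OF sum_abs] simp: abs_mult)
  also have "\<dots> = (\<Sum>j\<in>I. \<bar>a j\<bar> * (\<Sum>i\<in>I. T j i - \<epsilon> * w i))"
    by (subst sum.swap) (simp add: sum_distrib_left)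
  also have "\<dots> = (\<Sum>j\<in>I. \<bar>a j\<bar> * (1 - \<epsilon>))"
    using rows w by (intro sum.cong) (simp_all add: sum_subtractf flip: sum_distrib_left)
  finally show ?thesis
    by (simp add: mult.commute flip: sum_distrib_right)
qed

section \<open>Iterated laws of a kernel\<close>

lemma chain_law_Suc: "chain_law \<kappa> \<nu> (Suc n) = chain_law \<kappa> \<nu> n \<bind> \<kappa>"
  by (simp add: chain_law_def)

lemma chain_law_in_prob_algebra:
  assumes "\<kappa> \<in> M \<rightarrow>\<^sub>M prob_algebra M" "\<nu> \<in> space (prob_algebra M)"
  shows "chain_law \<kappa> \<nu> n \<in> space (prob_algebra M)"
proof (induction n)
  case 0
  then show ?case using assms by (simp add: chain_law_def)
next
  case (Suc n)
  have "(\<lambda>N. N \<bind> \<kappa>) \<in> prob_algebra M \<rightarrow>\<^sub>M prob_algebra M"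
    using assms(1) by simp
  from measurable_space[OF this Suc] show ?case by (simp add: chain_law_Suc)
qed

lemma chain_law_stationary:
  assumes "\<nu> \<bind> \<kappa> = \<nu>"
  shows "chain_law \<kappa> \<nu> n = \<nu>"
  by (induction n) (simp_all add: chain_law_Suc assms, simp add: chain_law_def)

section \<open>Total variation distance of probability measures\<close>

text \<open>A real \<open>SUP\<close> is a genuine least upper bound only over a bounded set; this
  makes the supremum in \<open>tv_dist\<close> usable.\<close>

lemma bdd_above_measure_diff:
  assumes "prob_space \<mu>" "prob_space \<nu>"
  shows "bdd_above ((\<lambda>A. \<bar>measure \<mu> A - measure \<nu> A\<bar>) ` S)"
proof (rule bdd_aboveI2)
  fix A
  show "\<bar>measure \<mu> A - measure \<nu> A\<bar> \<le> 1"
    using prob_space.prob_le_1[OF assms(1), of A] prob_space.prob_le_1[OF assms(2), of A]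
      measure_nonneg[of \<mu> A] measure_nonneg[of \<nu> A]
    by linarith
qed

lemma measure_diff_le_tv_dist:
  assumes "prob_space \<mu>" "prob_space \<nu>" "A \<in> sets \<mu>"
  shows "\<bar>measure \<mu> A - measure \<nu> A\<bar> \<le> tv_dist \<mu> \<nu>"
  unfolding tv_dist_def using bdd_above_measure_diff[OF assms(1,2)] assms(3)
  by (rule cSUP_upper[rotated])

lemma tv_dist_nonneg:
  assumes "prob_space \<mu>" "prob_space \<nu>"
  shows "0 \<le> tv_dist \<mu> \<nu>"
  using measure_diff_le_tv_dist[OF assms, of "{}"] by simp

lemma prob_measure_eqI:
  assumes "\<mu> \<in> space (prob_algebra M)" "\<nu> \<in> space (prob_algebra M)"
    and "\<And>A. A \<in> sets M \<Longrightarrow> measure \<mu> A = measure \<nu> A"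
  shows "\<mu> = \<nu>"
proof (rule measure_eqI)
  interpret \<mu>: prob_space \<mu> using assms(1) by (simp add: space_prob_algebra)
  interpret \<nu>: prob_space \<nu> using assms(2) by (simp add: space_prob_algebra)
  show "sets \<mu> = sets \<nu>"
    using assms(1,2) by (simp add: space_prob_algebra)
  show "emeasure \<mu> A = emeasure \<nu> A" if "A \<in> sets \<mu>" for A
    using that assms by (simp add: \<mu>.emeasure_eq_measure \<nu>.emeasure_eq_measure space_prob_algebra)
qed

lemma tv_dist_eq_0D:
  assumes "\<mu> \<in> space (prob_algebra M)" "\<nu> \<in> space (prob_algebra M)" "tv_dist \<mu> \<nu> = 0"
  shows "\<mu> = \<nu>"
  using assms(1,2)
proof (rule prob_measure_eqI)
  fix A assume "A \<in> sets M"
  then show "measure \<mu> A = measure \<nu> A"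
    using measure_diff_le_tv_dist[of \<mu> \<nu> A] assms by (simp add: space_prob_algebra)
qed

section \<open>Finite mixtures with positive densities\<close>

text \<open>Abstracts from the simplex: \<open>M\<close> is the reference measure, \<open>w\<close>
  the prior on labels, \<open>f i\<close> the noising density given label \<open>i\<close>.
  Positivity holds at every point, not just almost everywhere, so the posterior is defined and
  positive on all of \<open>space M\<close>.\<close>

locale finite_mixture =
  fixes M :: "'a measure" and I :: "'i set" and w :: "'i \<Rightarrow> real" and f :: "'i \<Rightarrow> 'a \<Rightarrow> real"
  assumes finite_I: "finite I"
    and w_pos: "i \<in> I \<Longrightarrow> 0 < w i"
    and sum_w: "(\<Sum>i\<in>I. w i) = 1"
    and f_measurable [measurable]: "i \<in> I \<Longrightarrow> f i \<in> borel_measurable M"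
    and f_pos: "i \<in> I \<Longrightarrow> x \<in> space M \<Longrightarrow> 0 < f i x"
    and f_integral: "i \<in> I \<Longrightarrow> (\<integral>\<^sup>+x. ennreal (f i x) \<partial>M) = 1"
begin

definition P :: "'i \<Rightarrow> 'a \<Rightarrow> real" where
  "P i x = w i * f i x / (\<Sum>j\<in>I. w j * f j x)"

definition Q :: "'i \<Rightarrow> 'a measure" where
  "Q i = density M (\<lambda>x. ennreal (f i x))"

definition mixture :: "('i \<Rightarrow> real) \<Rightarrow> 'a measure" where
  "mixture u = density M (\<lambda>x. ennreal (\<Sum>i\<in>I. u i * f i x))"

text \<open>This is the \<open>x\<close>-marginal of a two-block Gibbs sampler for the joint density
  \<open>w i * f i x\<close>: resample the label given the state, then the state given the
  label.\<close>

definition gibbs :: "'a \<Rightarrow> 'a measure" where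
  "gibbs x = mixture (\<lambda>i. P i x)"

text \<open>The law of the label drawn from the posterior at a state distributed as
  \<open>\<nu>\<close>. For \<open>\<nu> = Q j\<close> it is row \<open>j\<close> of the transition
  matrix on labels.\<close>

definition expected_posterior :: "'a measure \<Rightarrow> 'i \<Rightarrow> real" where
  "expected_posterior \<nu> i = (\<integral>x. P i x \<partial>\<nu>)"

lemma I_nonempty: "I \<noteq> {}"
  using sum_w by auto

lemma mixture_density_pos: "x \<in> space M \<Longrightarrow> 0 < (\<Sum>j\<in>I. w j * f j x)"
  using finite_I I_nonempty w_pos f_pos by (intro sum_pos) auto

lemma P_pos: "i \<in> I \<Longrightarrow> x \<in> space M \<Longrightarrow> 0 < P i x"
  using mixture_density_pos w_pos f_pos by (simp add: P_def)

lemma sum_P: "x \<in> space M \<Longrightarrow> (\<Sum>i\<in>I. P i x) = 1"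
  using mixture_density_pos[of x] by (simp add: P_def flip: sum_divide_distrib)

lemma abs_P_le_1:
  assumes "i \<in> I" "x \<in> space M"
  shows "\<bar>P i x\<bar> \<le> 1"
proof -
  have "P i x \<le> (\<Sum>i\<in>I. P i x)"
    using assms P_pos finite_I by (intro member_le_sum) (auto intro: less_imp_le)
  then show ?thesis using assms sum_P P_pos[of i x] by simp
qed

lemma P_measurable [measurable]: "i \<in> I \<Longrightarrow> P i \<in> borel_measurable M"
  unfolding P_def[abs_def] by measurable

lemma f_lebesgue_integral: "i \<in> I \<Longrightarrow> (\<integral>x. f i x \<partial>M) = 1"
  using f_integral[of i] f_pos[of i] by (subst integral_eq_nn_integral) (auto intro: less_imp_le)

lemma mixture_cong: "(\<And>i. i \<in> I \<Longrightarrow> u i = v i) \<Longrightarrow> mixture u = mixture v"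
  by (simp add: mixture_def)

lemma mixture_in_prob_algebra:
  assumes "\<And>i. i \<in> I \<Longrightarrow> 0 \<le> u i" "(\<Sum>i\<in>I. u i) = 1"
  shows "mixture u \<in> space (prob_algebra M)"
proof -
  have "(\<integral>\<^sup>+x. ennreal (\<Sum>i\<in>I. u i * f i x) \<partial>M) = (\<integral>\<^sup>+x. (\<Sum>i\<in>I. ennreal (u i) * ennreal (f i x)) \<partial>M)"
    using assms f_pos
    by (intro nn_integral_cong) (auto simp: ennreal_mult less_imp_le simp flip: sum_ennreal)
  also have "\<dots> = (\<Sum>i\<in>I. ennreal (u i))"
    by (subst nn_integral_sum) (auto simp: nn_integral_cmult f_integral)
  also have "\<dots> = 1"
    using assms by (simp add: sum_ennreal)
  finally show ?thesis
    by (auto simp: space_prob_algebra mixture_def emeasure_density cong: nn_integral_cong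
        intro!: prob_spaceI)
qed

lemma Q_in_prob_algebra: "i \<in> I \<Longrightarrow> Q i \<in> space (prob_algebra M)"
  by (auto simp: space_prob_algebra Q_def emeasure_density f_integral cong: nn_integral_cong
      intro!: prob_spaceI)

lemma integrable_bounded:
  fixes g :: "'a \<Rightarrow> real"
  assumes "\<nu> \<in> space (prob_algebra M)" "g \<in> borel_measurable M" "\<And>x. x \<in> space M \<Longrightarrow> \<bar>g x\<bar> \<le> B"
  shows "integrable \<nu> g"
proof -
  interpret prob_space \<nu> using assms(1) by (simp add: space_prob_algebra)
  have sets: "sets \<nu> = sets M" using assms(1) by (simp add: space_prob_algebra)
  show ?thesis
    using assms(2,3) sets_eq_imp_space_eq[OF sets]
    by (intro integrable_const_bound[where B = B]) (auto simp: measurable_cong_sets[OF sets])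
qed

lemma integral_Q:
  fixes g :: "'a \<Rightarrow> real"
  assumes "i \<in> I" "g \<in> borel_measurable M"
  shows "(\<integral>x. g x \<partial>Q i) = (\<integral>x. f i x * g x \<partial>M)"
  unfolding Q_def using assms f_pos by (subst integral_density) (auto intro: less_imp_le)

lemma integral_mixture:
  fixes g :: "'a \<Rightarrow> real"
  assumes u: "\<And>i. i \<in> I \<Longrightarrow> 0 \<le> u i"
    and g [measurable]: "g \<in> borel_measurable M" and B: "\<And>x. x \<in> space M \<Longrightarrow> \<bar>g x\<bar> \<le> B"
  shows "(\<integral>x. g x \<partial>mixture u) = (\<Sum>i\<in>I. u i * (\<integral>x. g x \<partial>Q i))"
proof -
  have integrable: "integrable M (\<lambda>x. f i x * g x)" if "i \<in> I" for i
  proof -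
    \<comment> \<open>A bounded \<open>g\<close> is integrable under the probability measure
      \<open>Q i\<close>; rewriting the density turns this into integrability of the product under
      \<open>M\<close>.\<close>
    have "integrable (density M (\<lambda>x. ennreal (f i x))) g"
      using integrable_bounded[OF Q_in_prob_algebra[OF that] g, of B] B by (simp add: Q_def)
    then show ?thesis
      using that f_pos by (subst (asm) integrable_density) (auto intro: less_imp_le)
  qed
  have "(\<integral>x. g x \<partial>mixture u) = (\<integral>x. (\<Sum>i\<in>I. u i * f i x) * g x \<partial>M)"
    unfolding mixture_def using u f_pos
    by (subst integral_density) (auto intro!: sum_nonneg AE_I2 mult_nonneg_nonneg simp: less_imp_le)
  also have "\<dots> = (\<integral>x. (\<Sum>i\<in>I. u i * (f i x * g x)) \<partial>M)"
    by (simp add: sum_distrib_right mult.assoc)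
  also have "\<dots> = (\<Sum>i\<in>I. u i * (\<integral>x. f i x * g x \<partial>M))"
    using integrable by (subst Bochner_Integration.integral_sum) auto
  finally show ?thesis
    using integral_Q by simp
qed

lemma measure_mixture:
  assumes "\<And>i. i \<in> I \<Longrightarrow> 0 \<le> u i" "A \<in> sets M"
  shows "measure (mixture u) A = (\<Sum>i\<in>I. u i * measure (Q i) A)"
  using integral_mixture[of u "indicat_real A" 1] assms sets.sets_into_space[OF assms(2)]
  by (simp add: mixture_def Q_def Int_absorb2)

section \<open>The Gibbs kernel and the weights it induces\<close>

lemma gibbs_in_prob_algebra: "x \<in> space M \<Longrightarrow> gibbs x \<in> space (prob_algebra M)"
  unfolding gibbs_def using P_pos sum_P by (intro mixture_in_prob_algebra) (auto intro: less_imp_le)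

text \<open>With \<open>sets M\<close> itself as the generator, it suffices that each event has a
  probability measurable in \<open>x\<close>. That probability is a combination of the
  \<open>P i x\<close> with coefficients independent of \<open>x\<close>.\<close>

lemma gibbs_measurable: "gibbs \<in> M \<rightarrow>\<^sub>M prob_algebra M"
proof (rule measurable_prob_algebra_generated[OF sets.sigma_sets_eq[symmetric] sets.Int_stable
      sets.space_closed])
  fix x assume x: "x \<in> space M"
  then show "prob_space (gibbs x)" "sets (gibbs x) = sets M"
    using gibbs_in_prob_algebra by (auto simp: space_prob_algebra)
next
  fix A assume A: "A \<in> sets M"
  have "emeasure (gibbs x) A = ennreal (\<Sum>i\<in>I. P i x * measure (Q i) A)" if "x \<in> space M" for x
  proof -
    interpret prob_space "gibbs x"
      using gibbs_in_prob_algebra[OF that] by (simp add: space_prob_algebra)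
    have "measure (gibbs x) A = (\<Sum>i\<in>I. P i x * measure (Q i) A)"
      unfolding gibbs_def using measure_mixture[OF _ A, of "\<lambda>i. P i x"] P_pos that
      by (simp add: less_imp_le)
    then show ?thesis by (simp add: emeasure_eq_measure)
  qed
  then show "(\<lambda>x. emeasure (gibbs x) A) \<in> borel_measurable M"
    by (subst measurable_cong) auto
qed

lemma expected_posterior_nonneg:
  assumes "\<nu> \<in> space (prob_algebra M)" "i \<in> I"
  shows "0 \<le> expected_posterior \<nu> i"
  unfolding expected_posterior_def using assms P_pos
  by (intro integral_nonneg_AE AE_I2)
    (auto simp: space_prob_algebra less_imp_le dest: sets_eq_imp_space_eq)

lemma P_integrable:
  assumes "\<nu> \<in> space (prob_algebra M)" "i \<in> I"
  shows "integrable \<nu> (P i)"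
  using assms abs_P_le_1 by (intro integrable_bounded[where B = 1]) auto

text \<open>A function positive on a whole probability space has a positive integral. Applied to
  \<open>Q j\<close>, this makes all entries of the transition matrix positive.\<close>

lemma expected_posterior_pos:
  assumes "\<nu> \<in> space (prob_algebra M)" "i \<in> I"
  shows "0 < expected_posterior \<nu> i"
proof -
  interpret prob_space \<nu> using assms(1) by (simp add: space_prob_algebra)
  have "(\<integral>x. 0 \<partial>\<nu>) < (\<integral>x. P i x \<partial>\<nu>)"
    using assms P_pos P_integrable[OF assms] emeasure_space_1
    by (intro integral_less_AE_space)
      (auto simp: space_prob_algebra dest: sets_eq_imp_space_eq intro!: AE_I2)
  then show ?thesis by (simp add: expected_posterior_def)
qed

lemma sum_expected_posterior:
  assumes "\<nu> \<in> space (prob_algebra M)"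
  shows "(\<Sum>i\<in>I. expected_posterior \<nu> i) = 1"
proof -
  interpret prob_space \<nu> using assms(1) by (simp add: space_prob_algebra)
  have "(\<Sum>i\<in>I. expected_posterior \<nu> i) = (\<integral>x. (\<Sum>i\<in>I. P i x) \<partial>\<nu>)"
    unfolding expected_posterior_def using P_integrable[OF assms]
    by (subst Bochner_Integration.integral_sum) auto
  also have "\<dots> = (\<integral>x. 1 \<partial>\<nu>)"
    using assms sum_P
    by (intro Bochner_Integration.integral_cong)
      (auto simp: space_prob_algebra dest: sets_eq_imp_space_eq)
  finally show ?thesis by (simp add: prob_space)
qed

text \<open>For a fixed event, \<open>gibbs x\<close> depends on \<open>x\<close> only through the
  posterior weights, and linearly, so averaging over \<open>\<nu>\<close> just averages those
  weights.\<close>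

lemma bind_gibbs:
  assumes "\<nu> \<in> space (prob_algebra M)"
  shows "\<nu> \<bind> gibbs = mixture (expected_posterior \<nu>)"
proof (rule prob_measure_eqI)
  interpret prob_space \<nu> using assms by (simp add: space_prob_algebra)
  have sets: "sets \<nu> = sets M" and space: "space \<nu> = space M"
    using assms by (auto simp: space_prob_algebra dest: sets_eq_imp_space_eq)
  have gibbs: "gibbs \<in> \<nu> \<rightarrow>\<^sub>M subprob_algebra M"
    using measurable_prob_algebraD[OF gibbs_measurable] by (simp add: measurable_cong_sets[OF sets])
  show "\<nu> \<bind> gibbs \<in> space (prob_algebra M)"
    using chain_law_in_prob_algebra[OF gibbs_measurable assms, of "Suc 0"]
    by (simp add: chain_law_def)
  show "mixture (expected_posterior \<nu>) \<in> space (prob_algebra M)"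
    using expected_posterior_nonneg[OF assms] sum_expected_posterior[OF assms]
    by (rule mixture_in_prob_algebra)
  fix A assume A: "A \<in> sets M"
  have "measure (\<nu> \<bind> gibbs) A = (\<integral>x. measure (gibbs x) A \<partial>\<nu>)"
    using gibbs A by (rule measure_bind)
  also have "\<dots> = (\<integral>x. (\<Sum>i\<in>I. P i x * measure (Q i) A) \<partial>\<nu>)"
    unfolding gibbs_def using measure_mixture[OF _ A] P_pos space
    by (intro Bochner_Integration.integral_cong) (auto simp: less_imp_le)
  also have "\<dots> = (\<Sum>i\<in>I. expected_posterior \<nu> i * measure (Q i) A)"
    unfolding expected_posterior_def using P_integrable[OF assms]
    by (subst Bochner_Integration.integral_sum) auto
  also have "\<dots> = measure (mixture (expected_posterior \<nu>)) A"
    using measure_mixture[OF expected_posterior_nonneg[OF assms] A] by simp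
  finally show "measure (\<nu> \<bind> gibbs) A = measure (mixture (expected_posterior \<nu>)) A" .
qed

lemma mixture_w_in_prob_algebra: "mixture w \<in> space (prob_algebra M)"
  using w_pos sum_w by (intro mixture_in_prob_algebra) (auto intro: less_imp_le)

text \<open>The density of \<open>mixture w\<close> is the normalizing denominator of
  \<open>P i\<close>. It cancels and leaves \<open>w i * f i x\<close>, whose integral is
  \<open>w i\<close>.\<close>

lemma expected_posterior_mixture_w:
  assumes "i \<in> I"
  shows "expected_posterior (mixture w) i = w i"
proof -
  have "expected_posterior (mixture w) i = (\<integral>x. (\<Sum>j\<in>I. w j * f j x) * P i x \<partial>M)"
    unfolding expected_posterior_def mixture_def using assms mixture_density_pos
    by (subst integral_density) (auto intro: less_imp_le)
  also have "\<dots> = (\<integral>x. w i * f i x \<partial>M)"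
    using mixture_density_pos
    by (intro Bochner_Integration.integral_cong refl) (force simp: P_def)
  finally show ?thesis
    using assms by (simp add: f_lebesgue_integral)
qed

lemma stationary_mixture_w: "mixture w \<bind> gibbs = mixture w"
  using bind_gibbs[OF mixture_w_in_prob_algebra]
    mixture_cong[of "expected_posterior (mixture w)" w] expected_posterior_mixture_w
  by simp

lemma expected_posterior_bind_gibbs:
  assumes "\<nu> \<in> space (prob_algebra M)" "i \<in> I"
  shows "expected_posterior (\<nu> \<bind> gibbs) i =
    (\<Sum>j\<in>I. expected_posterior \<nu> j * expected_posterior (Q j) i)"
  \<comment> \<open>Only occurrences at label \<open>i\<close> are unfolded, so the coefficients
    \<open>expected_posterior \<nu> j\<close> stay intact for
    \<open>integral_mixture\<close>.\<close>
  unfolding bind_gibbs[OF assms(1)] unfolding expected_posterior_def[of _ i]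
  using assms abs_P_le_1 expected_posterior_nonneg by (intro integral_mixture[where B = 1]) auto

section \<open>Geometric convergence and uniqueness of the stationary law\<close>

lemma minorization:
  obtains \<epsilon> where "0 < \<epsilon>" "\<epsilon> \<le> 1"
    "\<And>i j. i \<in> I \<Longrightarrow> j \<in> I \<Longrightarrow> \<epsilon> * w i \<le> expected_posterior (Q j) i"
proof
  \<comment> \<open>The constant is the least of finitely many positive ratios. Inserting 1 caps it,
    so that \<open>1 - \<epsilon>\<close> is nonnegative.\<close>
  define S where "S = insert 1 ((\<lambda>(i, j). expected_posterior (Q j) i / w i) ` (I \<times> I))"
  have S: "finite S" "S \<noteq> {}" "\<And>s. s \<in> S \<Longrightarrow> 0 < s"
    using finite_I w_pos expected_posterior_pos[OF Q_in_prob_algebra] by (auto simp: S_def)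
  then show "0 < Min S" by simp
  show "Min S \<le> 1" using S(1) by (auto simp: S_def)
  show "Min S * w i \<le> expected_posterior (Q j) i" if "i \<in> I" "j \<in> I" for i j
  proof -
    have "Min S \<le> expected_posterior (Q j) i / w i"
      using S(1) that by (auto intro!: Min_le simp: S_def)
    then show ?thesis using w_pos[OF that(1)] by (simp add: pos_le_divide_eq)
  qed
qed

text \<open>Both laws are mixtures of the same \<open>Q i\<close>, and each \<open>Q i\<close> gives
  an event mass at most 1, so only the differences of the weights count.\<close>

lemma tv_dist_bind_gibbs_le:
  assumes "\<nu> \<in> space (prob_algebra M)"
  shows "tv_dist (\<nu> \<bind> gibbs) (mixture w) \<le> (\<Sum>i\<in>I. \<bar>expected_posterior \<nu> i - w i\<bar>)"
  unfolding tv_dist_def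
proof (rule cSUP_least)
  fix A assume "A \<in> sets (\<nu> \<bind> gibbs)"
  then have A: "A \<in> sets M"
    by (simp add: bind_gibbs[OF assms] mixture_def)
  have "\<bar>measure (\<nu> \<bind> gibbs) A - measure (mixture w) A\<bar> =
      \<bar>\<Sum>i\<in>I. (expected_posterior \<nu> i - w i) * measure (Q i) A\<bar>"
    using measure_mixture[OF expected_posterior_nonneg[OF assms] A]
      measure_mixture[OF less_imp_le[OF w_pos] A]
    by (simp add: bind_gibbs[OF assms] left_diff_distrib sum_subtractf)
  also have "\<dots> \<le> (\<Sum>i\<in>I. \<bar>(expected_posterior \<nu> i - w i) * measure (Q i) A\<bar>)"
    by (rule sum_abs)
  also have "\<dots> \<le> (\<Sum>i\<in>I. \<bar>expected_posterior \<nu> i - w i\<bar>)"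
  proof (rule sum_mono)
    fix i assume "i \<in> I"
    then interpret prob_space "Q i"
      using Q_in_prob_algebra by (simp add: space_prob_algebra)
    show "\<bar>(expected_posterior \<nu> i - w i) * measure (Q i) A\<bar> \<le> \<bar>expected_posterior \<nu> i - w i\<bar>"
      by (simp add: abs_mult mult_left_le)
  qed
  finally show "\<bar>measure (\<nu> \<bind> gibbs) A - measure (mixture w) A\<bar> \<le>
    (\<Sum>i\<in>I. \<bar>expected_posterior \<nu> i - w i\<bar>)" .
qed auto

lemma gibbs_converges:
  assumes \<nu>: "\<nu> \<in> space (prob_algebra M)"
  shows "(\<lambda>n. tv_dist (chain_law gibbs \<nu> n) (mixture w)) \<longlonglongrightarrow> 0"
proof -
  obtain \<epsilon> where \<epsilon>: "0 < \<epsilon>" "\<epsilon> \<le> 1"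
    and minor: "\<And>i j. i \<in> I \<Longrightarrow> j \<in> I \<Longrightarrow> \<epsilon> * w i \<le> expected_posterior (Q j) i"
    by (rule minorization) auto
  \<comment> \<open>The weights at index \<open>n\<close> are the mixture coefficients of the law at
    time \<open>Suc n\<close>.\<close>
  define d where "d n = (\<Sum>i\<in>I. \<bar>expected_posterior (chain_law gibbs \<nu> n) i - w i\<bar>)" for n
  note chain = chain_law_in_prob_algebra[OF gibbs_measurable \<nu>]
  have d_Suc: "d (Suc n) \<le> (1 - \<epsilon>) * d n" for n
  proof -
    let ?a = "\<lambda>j. expected_posterior (chain_law gibbs \<nu> n) j - w j"
    \<comment> \<open>By stationarity \<open>w\<close> satisfies the same linear recursion as the
      weights of the chain, so their difference does too.\<close>
    have "expected_posterior (chain_law gibbs \<nu> (Suc n)) i - w i =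
        (\<Sum>j\<in>I. ?a j * expected_posterior (Q j) i)" if "i \<in> I" for i
      using expected_posterior_bind_gibbs[OF chain[of n] that]
        expected_posterior_bind_gibbs[OF mixture_w_in_prob_algebra that]
      by (simp add: chain_law_Suc stationary_mixture_w expected_posterior_mixture_w that
          left_diff_distrib sum_subtractf)
    then have "d (Suc n) = (\<Sum>i\<in>I. \<bar>\<Sum>j\<in>I. ?a j * expected_posterior (Q j) i\<bar>)"
      by (simp add: d_def)
    also have "\<dots> \<le> (1 - \<epsilon>) * d n"
      unfolding d_def using minor sum_w sum_expected_posterior[OF Q_in_prob_algebra]
        sum_expected_posterior[OF chain[of n]]
      by (intro doeblin_contraction[where w = w]) (auto simp: sum_subtractf)
    finally show ?thesis .
  qed
  have d_le: "d n \<le> (1 - \<epsilon>) ^ n * d 0" for n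
  proof (induction n)
    case (Suc n)
    then show ?case
      using order.trans[OF d_Suc[of n] mult_left_mono[OF Suc]] \<epsilon> by (simp add: mult.assoc)
  qed simp
  \<comment> \<open>The initial law is arbitrary and need not be a mixture, so the bound starts
    after one step; the index shift does not affect the limit.\<close>
  have "(\<lambda>n. tv_dist (chain_law gibbs \<nu> (Suc n)) (mixture w)) \<longlonglongrightarrow> 0"
  proof (rule tendsto_sandwich[OF _ _ tendsto_const])
    show "\<forall>\<^sub>F n in sequentially. 0 \<le> tv_dist (chain_law gibbs \<nu> (Suc n)) (mixture w)"
      using chain mixture_w_in_prob_algebra
      by (intro always_eventually allI tv_dist_nonneg) (auto simp: space_prob_algebra)
    show "\<forall>\<^sub>F n in sequentially.
        tv_dist (chain_law gibbs \<nu> (Suc n)) (mixture w) \<le> (1 - \<epsilon>) ^ n * d 0"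
      using tv_dist_bind_gibbs_le[OF chain] d_le
      by (intro always_eventually allI) (auto simp: chain_law_Suc d_def intro: order.trans)
    show "(\<lambda>n. (1 - \<epsilon>) ^ n * d 0) \<longlonglongrightarrow> 0"
      using \<epsilon> by (intro tendsto_mult_left_zero LIMSEQ_realpow_zero) auto
  qed
  then show ?thesis by (rule LIMSEQ_imp_Suc)
qed

text \<open>A chain started in a stationary law never moves, so its distance to
  \<open>mixture w\<close> is constant and, by convergence, zero.\<close>

lemma stationary_iff:
  assumes "\<nu> \<in> space (prob_algebra M)"
  shows "\<nu> \<bind> gibbs = \<nu> \<longleftrightarrow> \<nu> = mixture w"
proof
  assume "\<nu> \<bind> gibbs = \<nu>"
  then have "(\<lambda>n::nat. tv_dist \<nu> (mixture w)) \<longlonglongrightarrow> 0"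
    using gibbs_converges[OF assms] by (simp add: chain_law_stationary)
  then have "tv_dist \<nu> (mixture w) = 0"
    by (simp add: LIMSEQ_const_iff)
  then show "\<nu> = mixture w"
    using assms mixture_w_in_prob_algebra by (rule tv_dist_eq_0D[rotated 2])
qed (simp add: stationary_mixture_w)

end

section \<open>Transfer to the simplex\<close>

lemma space_simplex_measure: "space simplex_measure = prob_simplex"
  by (simp add: simplex_measure_def Let_def space_restrict_space)

lemma finite_categories: "finite (categories :: (real ^ 'k) set)"
  by (simp add: categories_def)

lemma bind_cong_space:
  assumes "\<nu> \<in> space (prob_algebra M)" "\<And>x. x \<in> space M \<Longrightarrow> \<kappa> x = \<kappa>' x"
  shows "\<nu> \<bind> \<kappa> = \<nu> \<bind> \<kappa>'"
  using assms by (intro bind_cong_All) (auto simp: space_prob_algebra dest: sets_eq_imp_space_eq)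

text \<open>The transition kernel is identified with \<open>gibbs\<close> only at points of the
  simplex. Measurability keeps every iterate a probability measure on \<open>M\<close>, so agreement
  on \<open>space M\<close> suffices.\<close>

lemma chain_law_cong:
  assumes \<nu>: "\<nu> \<in> space (prob_algebra M)" and \<kappa>: "\<kappa> \<in> M \<rightarrow>\<^sub>M prob_algebra M"
    and eq: "\<And>x. x \<in> space M \<Longrightarrow> \<kappa> x = \<kappa>' x"
  shows "chain_law \<kappa> \<nu> n = chain_law \<kappa>' \<nu> n"
proof (induction n)
  case (Suc n)
  then show ?case
    using bind_cong_space[OF chain_law_in_prob_algebra[OF \<kappa> \<nu>, of n] eq]
    by (simp add: chain_law_Suc)
qed (simp add: chain_law_def)

theorem proposition4p3:
  fixes p :: "(real ^ 'k) pmf"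
    and q :: "real \<Rightarrow> real ^ 'k \<Rightarrow> real ^ 'k \<Rightarrow> real"
    and r :: "real \<Rightarrow> real ^ 'k \<Rightarrow> real ^ 'k \<Rightarrow> real ^ 'k \<Rightarrow> real"
    and t :: real
  assumes time: "0 \<le> t" "t < 1"
    and data: "set_pmf p \<subseteq> categories"
    and noising: "\<And>x1. x1 \<in> categories \<Longrightarrow> simplex_density (\<lambda>x. q t x x1)"
    and posterior_full_support:
      "\<And>x1 x. x1 \<in> categories \<Longrightarrow> x \<in> prob_simplex \<Longrightarrow> 0 < posterior p (q t) x1 x"
    and noising_full_support:
      "\<And>x1 x. x1 \<in> categories \<Longrightarrow> x \<in> prob_simplex \<Longrightarrow> 0 < q t x x1"
    and cond_indep:
      "\<And>x1 x x'. x1 \<in> categories \<Longrightarrow> x \<in> prob_simplex \<Longrightarrow> x' \<in> prob_simplex \<Longrightarrow>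
         r t x' x x1 = q t x' x1"
  shows "(\<forall>x\<in>prob_simplex. \<forall>x'\<in>prob_simplex.
            transition_density p (q t) (r t) x' x =
              (\<Sum>x1\<in>categories. posterior p (q t) x1 x * q t x' x1)) \<and>
         transition_kernel p (q t) (r t) \<in> simplex_measure \<rightarrow>\<^sub>M prob_algebra simplex_measure \<and>
         noisy_marginal p (q t) \<in> space (prob_algebra simplex_measure) \<and>
         (\<forall>\<nu>\<in>space (prob_algebra simplex_measure).
            \<nu> \<bind> transition_kernel p (q t) (r t) = \<nu> \<longleftrightarrow> \<nu> = noisy_marginal p (q t)) \<and>
         (\<forall>\<nu>\<in>space (prob_algebra simplex_measure).
            (\<lambda>n. tv_dist (chain_law (transition_kernel p (q t) (r t)) \<nu> n)
                         (noisy_marginal p (q t))) \<longlonglongrightarrow> 0)"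
proof -
  let ?S = "simplex_measure :: (real ^ 'k) measure"
  let ?C = "categories :: (real ^ 'k) set"
  let ?K = "transition_kernel p (q t) (r t)"
  \<comment> \<open>An integral over an empty space is 0, whereas each noising density integrates to
    1. The resulting point \<open>x0\<close> is where the posterior can be evaluated.\<close>
  have "prob_simplex \<noteq> ({} :: (real ^ 'k) set)"
  proof
    assume "prob_simplex = ({} :: (real ^ 'k) set)"
    then have "(\<integral>\<^sup>+x. g x \<partial>?S) = 0" for g
      using nn_integral_empty[of ?S g] by (simp add: space_simplex_measure)
    moreover have "?C \<noteq> {}" by (simp add: categories_def)
    ultimately show False
      using noising unfolding simplex_density_def by auto
  qed
  then obtain x0 :: "real ^ 'k" where x0: "x0 \<in> prob_simplex" by auto
  \<comment> \<open>A category of prior weight zero would have posterior weight zero at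
    \<open>x0\<close>.\<close>
  have p_pos: "0 < pmf p x1" if "x1 \<in> ?C" for x1
    using posterior_full_support[OF that x0] by (cases "pmf p x1 = 0") (auto simp: posterior_def)
  interpret finite_mixture ?S ?C "pmf p" "\<lambda>x1 x. q t x x1"
    using noising noising_full_support p_pos sum_pmf_eq_1[OF finite_categories data]
    by unfold_locales
      (auto simp: finite_categories simplex_density_def space_simplex_measure)
  have marginal: "noisy_marginal p (q t) = mixture (pmf p)"
    by (simp add: noisy_marginal_def mixture_def)
  have transition: "transition_density p (q t) (r t) x' x =
      (\<Sum>x1\<in>?C. posterior p (q t) x1 x * q t x' x1)"
    if "x \<in> prob_simplex" "x' \<in> prob_simplex" for x x'
    using cond_indep that by (simp add: transition_density_def)
  have kernel: "?K x = gibbs x" if "x \<in> space ?S" for x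
  proof -
    let ?g = "\<lambda>x'. ennreal (\<Sum>x1\<in>?C. P x1 x * q t x' x1)"
    have eq: "ennreal (transition_density p (q t) (r t) x' x) = ?g x'" if "x' \<in> space ?S" for x'
      using transition that \<open>x \<in> space ?S\<close>
      by (simp add: space_simplex_measure P_def posterior_def)
    have [measurable]: "?g \<in> borel_measurable ?S"
      by measurable
    \<comment> \<open>Measurability is inherited from \<open>?g\<close>, which agrees with the
      transition density on the whole simplex.\<close>
    then have "(\<lambda>x'. ennreal (transition_density p (q t) (r t) x' x)) \<in> borel_measurable ?S"
      using eq by (subst measurable_cong) auto
    then show ?thesis
      unfolding transition_kernel_def gibbs_def mixture_def
      using eq by (intro density_cong) auto
  qed
  have kernel_measurable: "?K \<in> ?S \<rightarrow>\<^sub>M prob_algebra ?S"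
    using gibbs_measurable kernel by (subst measurable_cong) auto
  show ?thesis
    using transition kernel_measurable mixture_w_in_prob_algebra stationary_iff gibbs_converges
    by (auto simp: marginal bind_cong_space[OF _ kernel]
        chain_law_cong[OF _ kernel_measurable kernel])
qed

end
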